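(* Let $c_2>c_1>0$ and $c_2>c_3>0$ be fixed. Then for every sufficiently small $\epsilon\ge 0$ (with $\epsilon<c_1$, $\epsilon<c_3$; how small depends only on $c_1,c_2,c_3$) the following holds. Suppose that a function has two representations $$a(t)\cos\phi(t)=A(t)\cos\varphi(t)\qquad\text{for all } t\in\mathbb{R},$$ both of which are generalized intrinsic mode type (gIMT) representations in $\mathcal{Q}^{c_1,c_2,c_3}_{\epsilon}$. Define $t_m:=\phi^{-1}((m+1/2)\pi)$ and $s_m:=\phi^{-1}(m\pi)$ for $m\in\mathbb{Z}$, $\alpha(t):=A(t)-a(t)$ and $\beta(t):=\varphi(t)-\phi(t)$. Then there is $l\in\mathbb{Z}$ such that, after replacing $\varphi$ by $\varphi-2l\pi$ (and hence $\beta$ by $\beta-2l\pi$), all of the following hold. Values at $t_n$ and $s_n$: (1) $\beta(t_n)=0$ for all $n\in\mathbb{Z}$. (2) $\dfrac{a(t_n)}{a(t_n)+\alpha(t_n)}=\dfrac{\phi'(t_n)+\beta'(t_n)}{\phi'(t_n)}$ for all $n\in\mathbb{Z}$; in particular, for each $n\in\mathbb{Z}$, $\alpha(t_n)=0$ if and only if $\beta'(t_n)=0$. (3) $\dfrac{a(s_n)}{a(s_n)+\alpha(s_n)}=\cos(\beta(s_n))$ for all $n\in\mathbb{Z}$; in particular, for each $m\in\mathbb{Z}$, $\alpha(s_m)=0$ if and only if $\beta(s_m)=0$. Size bounds, for all $t\in\mathbb{R}$: (4) $|\alpha(t)|\le 2\pi\epsilon$. (5) $|\beta''(t)|\le 2\pi\epsilon$,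 $\ |\beta'(t)|\le \dfrac{2\pi\epsilon}{c_1}$ and $|\beta(t)|\le\dfrac{2\pi\epsilon}{c_1^2}$.
   Context: The class $\mathcal{Q}^{c_1,c_2,c_3}_{\epsilon}$ (generalized intrinsic mode type functions, gIMT), for constants $0\le\epsilon\ll1$, $c_2>c_1>\epsilon$, $c_2>c_3>\epsilon$, consists of the functions $g\in C^1(\mathbb{R})\cap L^\infty(\mathbb{R})$ of the form $g(t)=A(t)\cos(2\pi\psi(t))$, where - (regularity) $A\in C^1(\mathbb{R})\cap L^\infty(\mathbb{R})$ and $\psi\in C^3(\mathbb{R})$ are real valued; - (boundedness) $\inf_{t} A(t)\ge c_1$, $\inf_{t}\psi'(t)\ge c_1$, $\sup_{t}A(t)\le c_2$, $\sup_{t}\psi'(t)\le c_2$, $\sup_{t}|\psi''(t)|\le c_3$; - (growth) $|A'(t)|\le\epsilon\psi'(t)$ and $|\psi'''(t)|\le\epsilon\psi'(t)$ for all $t\in\mathbb{R}$. A representation $a(t)\cos\phi(t)$ is said to be a gIMT representation in $\mathcal{Q}^{c_1,c_2,c_3}_{\epsilon}$ if, with $\psi:=\phi/(2\pi)$ (so the cosine argument $\phi$ equals $2\pi\psi$), the pair $(a,\psi)$ satisfies: $a\in C^1(\mathbb{R})\cap L^\infty(\mathbb{R})$ and $\psi\in C^3(\mathbb{R})$ are real valued; $\inf_{t} a(t)\ge c_1$, $\inf_{t}\psi'(t)\ge c_1$, $\sup_{t}a(t)\le c_2$, $\sup_{t}\psi'(t)\le c_2$, $\sup_{t}|\psi''(t)|\le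 c_3$; and $|a'(t)|\le\epsilon\psi'(t)$ and $|\psi'''(t)|\le\epsilon\psi'(t)$ for all $t\in\mathbb{R}$. In particular $\phi$ is a strictly increasing bijection of $\mathbb{R}$, so $t_m,s_m$ are well defined. *)

theory Defs
  imports "HOL-Analysis.Analysis"
begin

definition C_k :: "nat \<Rightarrow> (real \<Rightarrow> real) \<Rightarrow> bool" where
  "C_k k f \<longleftrightarrow>
     (\<forall>j<k. (deriv ^^ j) f differentiable_on UNIV) \<and> continuous_on UNIV ((deriv ^^ k) f)"

(* The conditions on (A, psi) for A(t) * cos (2 * pi * psi(t)) to be a generalized intrinsic mode
   type (gIMT) function, i.e. an element of Q_epsilon^{c1,c2,c3}.
   A bound on an infimum or supremum is stated pointwise, since Inf and Sup on type real are
   meaningful only for bounded sets.  For the continuous function A, membership in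
   L^infinity is plain boundedness. *)
definition gIMT_pair ::
    "real \<Rightarrow> real \<Rightarrow> real \<Rightarrow> real \<Rightarrow> (real \<Rightarrow> real) \<Rightarrow> (real \<Rightarrow> real) \<Rightarrow> bool" where
  "gIMT_pair \<epsilon> c1 c2 c3 A \<psi> \<longleftrightarrow>
     C_k 1 A \<and> bounded (range A) \<and> C_k 3 \<psi> \<and>
     (\<forall>t. c1 \<le> A t) \<and> (\<forall>t. c1 \<le> deriv \<psi> t) \<and>
     (\<forall>t. A t \<le> c2) \<and> (\<forall>t. deriv \<psi> t \<le> c2) \<and> (\<forall>t. \<bar>(deriv ^^ 2) \<psi> t\<bar> \<le> c3) \<and>
     (\<forall>t. \<bar>deriv A t\<bar> \<le> \<epsilon> * deriv \<psi> t) \<and> (\<forall>t. \<bar>(deriv ^^ 3) \<psi> t\<bar> \<le> \<epsilon> * deriv \<psi> t)"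

(* Here phi is the full argument of the cosine, so the conditions apply to psi = phi / (2 * pi). *)
definition gIMT_rep ::
    "real \<Rightarrow> real \<Rightarrow> real \<Rightarrow> real \<Rightarrow> (real \<Rightarrow> real) \<Rightarrow> (real \<Rightarrow> real) \<Rightarrow> bool" where
  "gIMT_rep \<epsilon> c1 c2 c3 a \<phi> \<longleftrightarrow> gIMT_pair \<epsilon> c1 c2 c3 a (\<lambda>t. \<phi> t / (2 * pi))"

end

theory Submission
  imports Defs
begin

text \<open>
  Both phases pass through the zeros \<open>t\<^sub>n\<close> of the common function at half-integer multiples of \<open>\<pi>\<close>,
  consecutive zeros correspond to consecutive multiples, and comparing derivatives at \<open>t\<^sub>0\<close> fixes the
  parity of the shift; so after a shift by a multiple of \<open>2\<pi>\<close> the phase difference \<open>\<beta>\<close> vanishes at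
  every \<open>t\<^sub>n\<close>.  Since \<open>\<phi>'\<close> is bounded and \<open>\<phi>'''\<close> is of size \<open>\<epsilon>\<close>, \<open>\<phi>''\<close> is small and \<open>\<phi>'\<close> is nearly
  constant, say \<open>\<pi> / g\<close>, over two gaps between zeros.  There \<open>\<bar>\<beta>'''\<bar>\<close> is at most about \<open>2\<pi>\<epsilon> / g\<close>, and Taylor
  expansion at three neighbouring, nearly equidistant zeros of \<open>\<beta>\<close> bounds \<open>\<bar>\<beta>''\<bar>\<close> by about \<open>5/8 \<cdot> 2\<pi>\<epsilon>\<close>;
  the slack absorbs the deviation from equidistance.  Rolle's theorem and \<open>g \<le> 1/(2 c\<^sub>1)\<close> then give the
  bounds on \<open>\<beta>'\<close> and \<open>\<beta>\<close>.  Finally \<open>\<alpha> = A (1 - cos \<beta>) = O(\<epsilon>\<^sup>2)\<close> at \<open>s\<^sub>n\<close>, while \<open>\<alpha>\<close> varies by at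
  most \<open>\<epsilon>\<close> between consecutive zeros.
\<close>

section \<open>Taylor expansion, and a second-derivative bound from three zeros\<close>

lemma C_k_has_real_derivative:
  assumes "C_k k f" "j < k"
  shows "((deriv ^^ j) f has_real_derivative (deriv ^^ Suc j) f t) (at t)"
  using assms unfolding C_k_def
  by (auto simp: differentiable_on_def DERIV_deriv_iff_real_differentiable)

lemma taylor_second_order_bound:
  fixes f f1 f2 f3 :: "real \<Rightarrow> real"
  assumes f: "\<And>t. (f has_real_derivative f1 t) (at t)"
    and f1: "\<And>t. (f1 has_real_derivative f2 t) (at t)"
    and f2: "\<And>t. (f2 has_real_derivative f3 t) (at t)"
    and M: "\<And>s. s \<in> {u..v} \<Longrightarrow> \<bar>f3 s\<bar> \<le> M"
    and x: "x \<in> {u..v}" and t: "t \<in> {u..v}"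
  shows "\<bar>f x - (f t + f1 t * (x - t) + f2 t * (x - t)\<^sup>2 / 2)\<bar> \<le> M * \<bar>x - t\<bar> ^ 3 / 6"
proof (cases "x = t")
  case False
  \<comment> \<open>\<open>Taylor\<close> expects the derivatives as one family indexed by order.
    Orders 0 to 3 enter; \<open>f3\<close> is the default value beyond them.\<close>
  let ?d = "\<lambda>m::nat. if m = 0 then f else if m = 1 then f1 else if m = 2 then f2 else f3"
  have "\<forall>m s. m < 3 \<and> u \<le> s \<and> s \<le> v \<longrightarrow> DERIV (?d m) s :> ?d (Suc m) s"
    using f f1 f2 by (auto simp: less_Suc_eq numeral_3_eq_3)
  then obtain s where s: "if x < t then x < s \<and> s < t else t < s \<and> s < x"
      and eq: "f x = (\<Sum>m<3. ?d m t / fact m * (x - t) ^ m) + ?d 3 s / fact 3 * (x - t) ^ 3"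
    using Taylor[of 3 ?d f u v t x] False x t by auto
  have "f x - (f t + f1 t * (x - t) + f2 t * (x - t)\<^sup>2 / 2) = f3 s * (x - t) ^ 3 / 6"
    using eq by (simp add: numeral_3_eq_3 power2_eq_square field_simps)
  moreover have "\<bar>f3 s\<bar> \<le> M"
    using s x t by (intro M) (auto split: if_splits)
  ultimately show ?thesis
    by (simp only: abs_mult abs_divide power_abs) (simp add: mult_right_mono)
qed simp

text \<open>Taylor expansion about \<open>t\<close>, evaluated at the three zeros and combined as a
  second divided difference, isolates \<open>f2 t\<close> up to three cubic remainders. For
  equidistant zeros (\<open>m = g\<close>) the bound is \<open>5 / 8 * M * g\<close>; keeping
  \<open>m\<close> and \<open>g\<close> apart allows unequal gaps.\<close>

lemma second_derivative_bound_three_zeros: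
  fixes f f1 f2 f3 :: "real \<Rightarrow> real"
  assumes f: "\<And>t. (f has_real_derivative f1 t) (at t)"
    and f1: "\<And>t. (f1 has_real_derivative f2 t) (at t)"
    and f2: "\<And>t. (f2 has_real_derivative f3 t) (at t)"
    and M: "\<And>s. s \<in> {x0..x2} \<Longrightarrow> \<bar>f3 s\<bar> \<le> M"
    and zeros: "f x0 = 0" "f x1 = 0" "f x2 = 0"
    and gaps: "0 < m" "m \<le> x1 - x0" "m \<le> x2 - x1" "x1 - x0 \<le> g" "x2 - x1 \<le> g"
    and t: "t \<in> {x0..x2}" "\<bar>t - x1\<bar> \<le> g / 2"
  shows "\<bar>f2 t\<bar> * m\<^sup>2 \<le> 5 / 8 * M * g ^ 3"
proof -
  define h k where "h = x1 - x0" and "k = x2 - x1"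
  define u where "u = t - x1"
  define R where "R x = f x - (f t + f1 t * (x - t) + f2 t * (x - t)\<^sup>2 / 2)" for x
  have R: "\<bar>R x\<bar> \<le> M * \<bar>x - t\<bar> ^ 3 / 6" if "x \<in> {x0..x2}" for x
    unfolding R_def by (rule taylor_second_order_bound[OF f f1 f2 M that t(1)])
  have hk: "m \<le> h" "m \<le> k" "h \<le> g" "k \<le> g" "0 < h" "0 < k"
    using gaps by (auto simp: h_def k_def)
  have M0: "0 \<le> M" using M[OF t(1)] by linarith
  have u: "\<bar>u\<bar> \<le> g / 2" using t by (simp add: u_def)
  define D where "D = h * k * (h + k)"
  have D0: "0 < D" using hk by (simp add: D_def)
  \<comment> \<open>the weights \<open>k, -(h + k), h\<close> of the second divided difference annihilate affine functions\<close>
  have "f2 t / 2 * D = - (k * R x0 - (h + k) * R x1 + h * R x2)"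
  proof -
    have xs: "x0 - t = - h - u" "x1 - t = - u" "x2 - t = k - u"
      by (auto simp: h_def k_def u_def)
    show ?thesis
      unfolding R_def zeros D_def xs by (simp add: power2_eq_square field_simps)
  qed
  then have "\<bar>f2 t\<bar> / 2 * D = \<bar>k * R x0 - (h + k) * R x1 + h * R x2\<bar>"
    using D0 by (metis abs_minus abs_mult abs_of_pos abs_divide abs_numeral)
  also have "\<dots> \<le> k * \<bar>R x0\<bar> + (h + k) * \<bar>R x1\<bar> + h * \<bar>R x2\<bar>"
  proof -
    have "\<bar>k * R x0\<bar> = k * \<bar>R x0\<bar>" "\<bar>(h + k) * R x1\<bar> = (h + k) * \<bar>R x1\<bar>" "\<bar>h * R x2\<bar> = h * \<bar>R x2\<bar>"
      using hk by (auto simp: abs_mult)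
    then show ?thesis by linarith
  qed
  also have "\<dots> \<le> k * (M * \<bar>x0 - t\<bar> ^ 3 / 6) + (h + k) * (M * \<bar>x1 - t\<bar> ^ 3 / 6) + h * (M * \<bar>x2 - t\<bar> ^ 3 / 6)"
    using hk by (intro add_mono mult_left_mono R) (auto simp: h_def k_def)
  also have "\<dots> = M / 6 * (k * \<bar>x0 - t\<bar> ^ 3 + (h + k) * \<bar>x1 - t\<bar> ^ 3 + h * \<bar>x2 - t\<bar> ^ 3)"
    by (simp add: algebra_simps)
  finally have "\<bar>f2 t\<bar> * D \<le> M / 3 * (k * \<bar>x0 - t\<bar> ^ 3 + (h + k) * \<bar>x1 - t\<bar> ^ 3 + h * \<bar>x2 - t\<bar> ^ 3)"
    by (simp add: mult_ac)
  then have "\<bar>f2 t\<bar> * D * m\<^sup>2 \<le> M / 3 * (k * \<bar>x0 - t\<bar> ^ 3 + (h + k) * \<bar>x1 - t\<bar> ^ 3 + h * \<bar>x2 - t\<bar> ^ 3) * m\<^sup>2"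
    by (intro mult_right_mono) auto
  also have "\<dots> = M / 3 * (k * m\<^sup>2 * \<bar>x0 - t\<bar> ^ 3 + (h + k) * m\<^sup>2 * \<bar>x1 - t\<bar> ^ 3 + h * m\<^sup>2 * \<bar>x2 - t\<bar> ^ 3)"
    by (simp add: algebra_simps)
  \<comment> \<open>Since \<open>m\<close> is at most both gaps, the unequal weights
    \<open>k\<close> and \<open>h\<close> can be replaced by the common weight \<open>D / 2\<close>,
    so that the two outer cubes can be estimated together.\<close>
  also have "\<dots> \<le> M / 3 * (D / 2 * \<bar>x0 - t\<bar> ^ 3 + D * \<bar>x1 - t\<bar> ^ 3 + D / 2 * \<bar>x2 - t\<bar> ^ 3)"
  proof -
    have mm: "m\<^sup>2 \<le> h * k" "m\<^sup>2 \<le> h * h" "m\<^sup>2 \<le> k * k"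
      using hk gaps by (auto simp: power2_eq_square intro!: mult_mono)
    have "k * m\<^sup>2 * 2 \<le> k * (h * (h + k))" "h * m\<^sup>2 * 2 \<le> h * (k * (h + k))"
      unfolding mult.assoc using mm hk by (intro mult_left_mono; simp add: algebra_simps)+
    moreover have "m\<^sup>2 * (h + k) \<le> h * k * (h + k)"
      using mm hk by (intro mult_right_mono) auto
    ultimately have "k * m\<^sup>2 \<le> D / 2" "h * m\<^sup>2 \<le> D / 2" "(h + k) * m\<^sup>2 \<le> D"
      by (auto simp: D_def algebra_simps)
    then show ?thesis
      using M0 by (intro mult_left_mono add_mono mult_right_mono) auto
  qed
  also have "\<dots> = D * (M / 3 * ((\<bar>x0 - t\<bar> ^ 3 + \<bar>x2 - t\<bar> ^ 3) / 2 + \<bar>x1 - t\<bar> ^ 3))"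
    by (simp add: algebra_simps)
  also have "\<dots> \<le> D * (M / 3 * (15 / 8 * g ^ 3))"
  proof -
    let ?v = "\<bar>u\<bar>"
    \<comment> \<open>When \<open>t\<close> is off \<open>x1\<close> by \<open>?v\<close>, one outer
      distance is at most \<open>g + ?v\<close> and the other at most \<open>g - ?v\<close>; odd
      powers of \<open>?v\<close> cancel in the sum of cubes. With \<open>?v\<close> at most
      \<open>g / 2\<close> the factor is 7/2, and 7/4 + 1/8 = 15/8.\<close>
    have "\<bar>x0 - t\<bar> ^ 3 + \<bar>x2 - t\<bar> ^ 3 \<le> (g + ?v) ^ 3 + (g - ?v) ^ 3"
    proof (cases "u \<ge> 0")
      case True
      then have "\<bar>x0 - t\<bar> \<le> g + ?v" "\<bar>x2 - t\<bar> \<le> g - ?v"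
        using t gaps by (auto simp: u_def)
      then show ?thesis by (intro add_mono power_mono) auto
    next
      case False
      then have "\<bar>x0 - t\<bar> \<le> g - ?v" "\<bar>x2 - t\<bar> \<le> g + ?v"
        using t gaps by (auto simp: u_def)
      then have "\<bar>x0 - t\<bar> ^ 3 + \<bar>x2 - t\<bar> ^ 3 \<le> (g - ?v) ^ 3 + (g + ?v) ^ 3"
        by (intro add_mono power_mono) auto
      then show ?thesis by simp
    qed
    also have "\<dots> = 2 * g ^ 3 + 6 * g * ?v\<^sup>2"
      by (simp add: power2_eq_square power3_eq_cube algebra_simps)
    also have "\<dots> \<le> 2 * g ^ 3 + 6 * g * (g / 2)\<^sup>2"
      using u gaps by (intro add_left_mono mult_left_mono power_mono) auto
    also have "\<dots> = 7 / 2 * g ^ 3"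
      by (simp add: power2_eq_square power3_eq_cube)
    finally have 1: "\<bar>x0 - t\<bar> ^ 3 + \<bar>x2 - t\<bar> ^ 3 \<le> 7 / 2 * g ^ 3" .
    have "\<bar>x1 - t\<bar> ^ 3 \<le> (g / 2) ^ 3"
      using t(2) by (intro power_mono) (simp_all add: abs_minus_commute)
    then have "\<bar>x1 - t\<bar> ^ 3 \<le> g ^ 3 / 8" by (simp add: power_divide)
    moreover have "x / 2 + y \<le> 15 / 8 * z" if "x \<le> 7 / 2 * z" "y \<le> z / 8" for x y z :: real
      using that by linarith
    ultimately have "(\<bar>x0 - t\<bar> ^ 3 + \<bar>x2 - t\<bar> ^ 3) / 2 + \<bar>x1 - t\<bar> ^ 3 \<le> 15 / 8 * g ^ 3"
      using 1 by blast
    then show ?thesis using D0 M0 by (intro mult_left_mono) auto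
  qed
  finally have "D * (\<bar>f2 t\<bar> * m\<^sup>2) \<le> D * (5 / 8 * M * g ^ 3)"
    by (simp add: algebra_simps)
  then show ?thesis using D0 by simp
qed

section \<open>A single phase: growth, surjectivity, nearly constant slope\<close>

text \<open>\<open>\<phi>\<close> is the full argument of the cosine, so the slope bounds carry a
  factor 2 pi, while the growth condition on the third derivative is homogeneous and keeps its
  constant \<epsilon>.\<close>

locale phase =
  fixes c1 c2 \<epsilon> :: real and \<phi> \<phi>1 \<phi>2 \<phi>3 :: "real \<Rightarrow> real"
  assumes D0: "\<And>t. (\<phi> has_real_derivative \<phi>1 t) (at t)"
    and D1: "\<And>t. (\<phi>1 has_real_derivative \<phi>2 t) (at t)"
    and D2: "\<And>t. (\<phi>2 has_real_derivative \<phi>3 t) (at t)"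
    and c1_pos: "0 < c1" and \<epsilon>_nonneg: "0 \<le> \<epsilon>"
    and lower: "\<And>t. 2 * pi * c1 \<le> \<phi>1 t" and upper: "\<And>t. \<phi>1 t \<le> 2 * pi * c2"
    and third: "\<And>t. \<bar>\<phi>3 t\<bar> \<le> \<epsilon> * \<phi>1 t"
begin

lemma \<phi>1_pos: "0 < \<phi>1 t"
  using lower[of t] c1_pos pi_gt_zero by (smt (verit) mult_pos_pos)

lemma \<phi>_mvt:
  assumes "x < y" obtains z where "x < z" "z < y" "\<phi> y - \<phi> x = (y - x) * \<phi>1 z"
  using MVT2[OF assms D0] by auto

lemma increase: "x \<le> y \<Longrightarrow> 2 * pi * c1 * (y - x) \<le> \<phi> y - \<phi> x"
proof (cases "x = y")
  case False
  assume "x \<le> y"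
  with False have "x < y" by simp
  then obtain z where "\<phi> y - \<phi> x = (y - x) * \<phi>1 z" by (rule \<phi>_mvt)
  then show ?thesis
    using mult_right_mono[OF lower[of z], of "y - x"] \<open>x \<le> y\<close> by (simp add: mult.commute)
qed simp

lemma strict_mono: "strict_mono \<phi>"
  by (rule strict_monoI, rule DERIV_pos_imp_increasing) (use D0 \<phi>1_pos in auto)

lemma less_iff: "\<phi> x < \<phi> y \<longleftrightarrow> x < y" and le_iff: "\<phi> x \<le> \<phi> y \<longleftrightarrow> x \<le> y"
  using strict_mono by (auto simp: strict_mono_less strict_mono_less_eq)

text \<open>A slope of at least \<open>2 * pi * c1\<close> tells how far to go out from 0 to bracket
  any value \<open>y\<close>. Thus nodes and peaks defined through \<open>inv \<phi>\<close> are
  genuine preimages.\<close>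

lemma surj: "surj \<phi>"
proof -
  have "\<exists>x. \<phi> x = y" for y
  proof -
    define L where "L = 2 * pi * c1"
    have L: "L > 0" using c1_pos by (simp add: L_def)
    define r where "r = \<bar>y - \<phi> 0\<bar> / L"
    have r: "r \<ge> 0" "L * r = \<bar>y - \<phi> 0\<bar>" using L by (auto simp: r_def)
    have "\<phi> (- r) \<le> y" "y \<le> \<phi> r"
      using increase[of 0 r] increase[of "- r" 0] r by (auto simp: L_def)
    moreover have "continuous_on {- r..r} \<phi>"
      by (rule DERIV_continuous_on[OF has_field_derivative_at_within[OF D0]])
    ultimately show ?thesis using IVT'[of \<phi> "- r" y r] r by auto
  qed
  then show ?thesis by (metis surj_def)
qed

lemma at_inv: "\<phi> (inv \<phi> y) = y"
  by (rule surj_f_inv_f[OF surj])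

text \<open>Landau's interpolation argument, with step \<open>H\<close> chosen to balance the two contributions.\<close>

lemma \<phi>2_small:
  assumes "0 < d" "\<epsilon> \<le> d\<^sup>2 / (4 * c2\<^sup>2)"
  shows "\<bar>\<phi>2 t\<bar> \<le> 2 * pi * d"
proof -
  have c2: "0 < c2"
    using \<phi>1_pos[of 0] upper[of 0] pi_gt_zero by (smt (verit) mult_nonneg_nonpos)
  define H where "H = 2 * c2 / d"
  have H: "0 < H" using assms c2 by (simp add: H_def)
  obtain z where z: "t < z" "z < t + H" "\<phi>1 (t + H) - \<phi>1 t = H * \<phi>2 z"
    using MVT2[of t "t + H" \<phi>1 \<phi>2] D1 H by auto
  obtain w where w: "\<phi>2 z - \<phi>2 t = (z - t) * \<phi>3 w"
    using MVT2[of t z \<phi>2 \<phi>3] D2 z by auto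
  have "H * \<bar>\<phi>2 z\<bar> = \<bar>\<phi>1 (t + H) - \<phi>1 t\<bar>" using z H by (simp add: abs_mult)
  also have "\<dots> \<le> 2 * pi * c2"
    using upper[of t] upper[of "t + H"] \<phi>1_pos[of t] \<phi>1_pos[of "t + H"] by linarith
  finally have "\<bar>\<phi>2 z\<bar> \<le> pi * d"
    using H c2 assms by (simp add: H_def field_simps)
  moreover have "\<bar>\<phi>2 z - \<phi>2 t\<bar> \<le> pi * d"
  proof -
    have "\<bar>\<phi>3 w\<bar> \<le> \<epsilon> * (2 * pi * c2)"
      using third[of w] upper[of w] \<epsilon>_nonneg by (meson mult_left_mono order_trans)
    then have "\<bar>\<phi>2 z - \<phi>2 t\<bar> \<le> H * (\<epsilon> * (2 * pi * c2))"
      unfolding w abs_mult using z by (intro mult_mono) auto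
    also have "\<dots> \<le> H * (d\<^sup>2 / (4 * c2\<^sup>2) * (2 * pi * c2))"
      using assms H c2 by (intro mult_left_mono mult_right_mono) auto
    also have "\<dots> = pi * d"
      using assms c2 by (simp add: H_def power2_eq_square field_simps)
    finally show ?thesis .
  qed
  ultimately show ?thesis by linarith
qed


text \<open>The threshold is that of \<open>\<phi>2_small\<close> with
  \<open>d = c1\<^sup>2 / 10\<close>. Over a distance \<open>1 / c1\<close>, which covers two gaps
  between nodes, the slope then drifts by at most a tenth of its lower bound
  \<open>2 * pi * c1\<close>.\<close>

lemma nearly_constant:
  assumes "\<epsilon> \<le> (c1\<^sup>2 / 10)\<^sup>2 / (4 * c2\<^sup>2)" "\<bar>s - r\<bar> \<le> 1 / c1"
  shows "\<phi>1 s \<le> 11 / 10 * \<phi>1 r"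
proof -
  have "\<bar>\<phi>2 t\<bar> \<le> 2 * pi * (c1\<^sup>2 / 10)" for t
    using \<phi>2_small[OF _ assms(1)] c1_pos by simp
  then have "\<bar>\<phi>1 s - \<phi>1 r\<bar> \<le> 2 * pi * (c1\<^sup>2 / 10) * \<bar>s - r\<bar>"
    using field_differentiable_bound[of UNIV \<phi>1 \<phi>2 "2 * pi * (c1\<^sup>2 / 10)" s r] D1 by simp
  also have "\<dots> \<le> 2 * pi * (c1\<^sup>2 / 10) * (1 / c1)"
    using assms by (intro mult_left_mono) auto
  also have "\<dots> = 2 * pi * c1 / 10"
    using c1_pos by (simp add: power2_eq_square)
  finally show ?thesis using lower[of r] by linarith
qed

end

text \<open>Both \<open>W - f\<close> and \<open>W + f\<close> are nondecreasing. Later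
  \<open>W\<close> is a multiple of the sum of the two phases, which turns the growth conditions on
  the amplitudes into a variation bound across a gap.\<close>

lemma abs_diff_le_of_deriv_le:
  fixes f W :: "real \<Rightarrow> real"
  assumes f: "\<And>t. (f has_real_derivative f' t) (at t)"
    and W: "\<And>t. (W has_real_derivative W' t) (at t)"
    and le: "\<And>t. \<bar>f' t\<bar> \<le> W' t" and "x \<le> y"
  shows "\<bar>f y - f x\<bar> \<le> W y - W x"
proof -
  have 1: "((\<lambda>t. W t - f t) has_real_derivative W' t - f' t) (at t)"
   and 2: "((\<lambda>t. W t + f t) has_real_derivative W' t + f' t) (at t)" for t
    using f W by (auto intro: DERIV_diff DERIV_add)
  have "0 \<le> W' t - f' t" "0 \<le> W' t + f' t" for t
    using le[of t] by linarith+
  with 1 2 have "W x - f x \<le> W y - f y" "W x + f x \<le> W y + f y"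
    using DERIV_nonneg_imp_nondecreasing[OF \<open>x \<le> y\<close>, of "\<lambda>t. W t - f t"]
      DERIV_nonneg_imp_nondecreasing[OF \<open>x \<le> y\<close>, of "\<lambda>t. W t + f t"] by blast+
  then show ?thesis by linarith
qed

section \<open>Two phases with common nodes: bounds on their difference\<close>

text \<open>\<open>\<theta>\<close> stands for the second phase after its shift by a multiple of 2
  pi, and \<open>\<tau>\<close> enumerates the zeros of the common function, so the difference
  \<beta> of the phases vanishes at every node.\<close>

locale phase_pair =
  p: phase c1 c2 \<epsilon> \<phi> \<phi>1 \<phi>2 \<phi>3 + q: phase c1 c2 \<epsilon> \<theta> \<theta>1 \<theta>2 \<theta>3
  for c1 c2 \<epsilon> \<phi> \<phi>1 \<phi>2 \<phi>3 \<theta> \<theta>1 \<theta>2 \<theta>3 +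
  fixes \<tau> :: "int \<Rightarrow> real"
  assumes \<phi>_\<tau>: "\<phi> (\<tau> n) = (of_int n + 1 / 2) * pi"
    and \<theta>_\<tau>: "\<theta> (\<tau> n) = (of_int n + 1 / 2) * pi"
begin

lemma \<tau>_less: "\<tau> n < \<tau> (n + 1)"
  by (rule p.less_iff[THEN iffD1]) (simp add: \<phi>_\<tau>)

lemma gap_le: "\<tau> (n + 1) - \<tau> n \<le> 1 / (2 * c1)"
proof -
  have "pi * (2 * c1 * (\<tau> (n + 1) - \<tau> n)) \<le> pi * 1"
    using p.increase[of "\<tau> n" "\<tau> (n + 1)"] \<tau>_less[of n] by (simp add: \<phi>_\<tau> algebra_simps)
  then have "2 * c1 * (\<tau> (n + 1) - \<tau> n) \<le> 1"
    by (rule mult_le_cancel_left_pos[OF pi_gt_zero, THEN iffD1])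
  then show ?thesis using p.c1_pos by (simp add: field_simps)
qed

lemma gap_le_inverse: "\<tau> (n + 1) - \<tau> n \<le> 1 / c1"
proof -
  have "1 / (2 * c1) \<le> 1 / c1" using p.c1_pos by (simp add: field_simps)
  with gap_le[of n] show ?thesis by linarith
qed

lemma locate: obtains n where "\<tau> n \<le> t" "t < \<tau> (n + 1)"
proof
  let ?n = "\<lfloor>\<phi> t / pi - 1 / 2\<rfloor>"
  have "(of_int ?n + 1 / 2) * pi \<le> \<phi> t / pi * pi"
    by (intro mult_right_mono pi_ge_zero) linarith
  then show "\<tau> ?n \<le> t" by (subst p.le_iff[symmetric]) (simp add: \<phi>_\<tau>)
  have "\<phi> t / pi * pi < (of_int (?n + 1) + 1 / 2) * pi"
    by (intro mult_strict_right_mono pi_gt_zero) linarith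
  then show "t < \<tau> (?n + 1)" by (subst p.less_iff[symmetric]) (simp add: \<phi>_\<tau>)
qed

lemma third_diff: "\<bar>\<theta>3 t - \<phi>3 t\<bar> \<le> \<epsilon> * (\<phi>1 t + \<theta>1 t)"
  using p.third[of t] q.third[of t] by (simp add: algebra_simps)

context
  assumes \<epsilon>_small: "\<epsilon> \<le> (c1\<^sup>2 / 10)\<^sup>2 / (4 * c2\<^sup>2)"
begin

text \<open>By the mean value theorem, slope times gap equals pi at some point of the gap. Every
  \<open>s\<close> in the double gap lies within \<open>1 / c1\<close> of that point, so near
  constancy costs a factor 11/10.\<close>

lemma derivative_times_gap:
  assumes s: "s \<in> {\<tau> k..\<tau> (k + 2)}" and n: "n \<in> {k, k + 1}"
  shows "\<phi>1 s * (\<tau> (n + 1) - \<tau> n) \<le> 11 / 10 * pi" "\<theta>1 s * (\<tau> (n + 1) - \<tau> n) \<le> 11 / 10 * pi"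
proof -
  have mono: "\<tau> k < \<tau> (k + 1)" "\<tau> (k + 1) < \<tau> (k + 2)"
    using \<tau>_less[of k] \<tau>_less[of "k + 1"] by (simp_all add: add.assoc)
  have "\<tau> (k + 2) - \<tau> k \<le> 1 / (2 * c1) + 1 / (2 * c1)"
    using gap_le[of k] gap_le[of "k + 1"] by (simp add: add.assoc)
  then have near: "\<bar>s - z\<bar> \<le> 1 / c1" if "\<tau> n < z" "z < \<tau> (n + 1)" for z
    using that s n mono by (auto simp: add.assoc)
  obtain z where z: "\<tau> n < z" "z < \<tau> (n + 1)" "\<phi> (\<tau> (n + 1)) - \<phi> (\<tau> n) = (\<tau> (n + 1) - \<tau> n) * \<phi>1 z"
    using p.\<phi>_mvt[OF \<tau>_less] .
  have "\<phi>1 s * (\<tau> (n + 1) - \<tau> n) \<le> 11 / 10 * \<phi>1 z * (\<tau> (n + 1) - \<tau> n)"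
    using p.nearly_constant[OF \<epsilon>_small near[OF z(1,2)]] \<tau>_less[of n] by (intro mult_right_mono) auto
  also have "\<dots> = 11 / 10 * pi" using z(3) by (simp add: \<phi>_\<tau> algebra_simps)
  finally show "\<phi>1 s * (\<tau> (n + 1) - \<tau> n) \<le> 11 / 10 * pi" .
  obtain z where z: "\<tau> n < z" "z < \<tau> (n + 1)" "\<theta> (\<tau> (n + 1)) - \<theta> (\<tau> n) = (\<tau> (n + 1) - \<tau> n) * \<theta>1 z"
    using q.\<phi>_mvt[OF \<tau>_less] .
  have "\<theta>1 s * (\<tau> (n + 1) - \<tau> n) \<le> 11 / 10 * \<theta>1 z * (\<tau> (n + 1) - \<tau> n)"
    using q.nearly_constant[OF \<epsilon>_small near[OF z(1,2)]] \<tau>_less[of n] by (intro mult_right_mono) auto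
  also have "\<dots> = 11 / 10 * pi" using z(3) by (simp add: \<theta>_\<tau> algebra_simps)
  finally show "\<theta>1 s * (\<tau> (n + 1) - \<tau> n) \<le> 11 / 10 * pi" .
qed

text \<open>At the point where the slope of \<open>\<phi>\<close> times gap \<open>m\<close> equals
  pi, the previous bound applies to gap \<open>n\<close>; the slope then cancels.\<close>

lemma gap_compare:
  assumes n: "n \<in> {k, k + 1}" and m: "m \<in> {k, k + 1}"
  shows "\<tau> (n + 1) - \<tau> n \<le> 11 / 10 * (\<tau> (m + 1) - \<tau> m)"
proof -
  obtain z where z: "\<tau> m < z" "z < \<tau> (m + 1)" "\<phi> (\<tau> (m + 1)) - \<phi> (\<tau> m) = (\<tau> (m + 1) - \<tau> m) * \<phi>1 z"
    using p.\<phi>_mvt[OF \<tau>_less] .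
  have "z \<in> {\<tau> k..\<tau> (k + 2)}"
    using m z(1,2) \<tau>_less[of k] \<tau>_less[of "k + 1"] by (auto simp: add.assoc)
  from derivative_times_gap(1)[OF this n]
  have "\<phi>1 z * (\<tau> (n + 1) - \<tau> n) \<le> \<phi>1 z * (11 / 10 * (\<tau> (m + 1) - \<tau> m))"
    using z(3) by (simp add: \<phi>_\<tau> algebra_simps)
  then show ?thesis using p.\<phi>1_pos[of z] by simp
qed

lemma second_diff_near_node:
  assumes t: "t \<in> {\<tau> k..\<tau> (k + 2)}"
    and near: "\<bar>t - \<tau> (k + 1)\<bar> \<le> max (\<tau> (k + 1) - \<tau> k) (\<tau> (k + 2) - \<tau> (k + 1)) / 2"
  shows "\<bar>\<theta>2 t - \<phi>2 t\<bar> \<le> 2 * pi * \<epsilon>"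
proof -
  define h where "h n = \<tau> (n + 1) - \<tau> n" for n
  have h2: "\<tau> (k + 2) - \<tau> (k + 1) = h (k + 1)" by (simp add: h_def add.assoc)
  define g where "g = max (h k) (h (k + 1))"
  define m where "m = min (h k) (h (k + 1))"
  have h_pos: "0 < h n" for n using \<tau>_less by (simp add: h_def)
  have pos: "0 < g" "0 < m" using h_pos by (auto simp: g_def m_def less_max_iff_disj)
  have "h k \<le> 11 / 10 * h (k + 1)" "h (k + 1) \<le> 11 / 10 * h k"
    unfolding h_def by (rule gap_compare[of _ k]; simp)+
  then have gm: "g \<le> 11 / 10 * m"
    using h_pos[of k] h_pos[of "k + 1"] by (auto simp: g_def m_def max_def min_def)
  \<comment> \<open>The larger gap \<open>g\<close> is itself one of the two gaps, so each slope is
    at most 11/10 pi / \<open>g\<close>; the two phases together give 22/10.\<close>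
  have "\<bar>\<theta>3 s - \<phi>3 s\<bar> \<le> \<epsilon> * (22 / 10 * pi / g)" if s: "s \<in> {\<tau> k..\<tau> (k + 2)}" for s
  proof -
    have "g = h k \<or> g = h (k + 1)" by (auto simp: g_def max_def)
    then obtain n where n: "n \<in> {k, k + 1}" "g = h n" by blast
    have "(\<phi>1 s + \<theta>1 s) * g \<le> 22 / 10 * pi"
      using derivative_times_gap[OF s n(1)] by (simp add: n(2) h_def algebra_simps)
    then have "\<phi>1 s + \<theta>1 s \<le> 22 / 10 * pi / g" using pos by (simp add: pos_le_divide_eq)
    then have "\<epsilon> * (\<phi>1 s + \<theta>1 s) \<le> \<epsilon> * (22 / 10 * pi / g)" using p.\<epsilon>_nonneg by (rule mult_left_mono)
    with third_diff[of s] show ?thesis by linarith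
  qed
  then have "\<bar>\<theta>2 t - \<phi>2 t\<bar> * m\<^sup>2 \<le> 5 / 8 * (\<epsilon> * (22 / 10 * pi / g)) * g ^ 3"
    using t near pos
    by (intro second_derivative_bound_three_zeros[where f = "\<lambda>t. \<theta> t - \<phi> t" and ?f1.0 = "\<lambda>t. \<theta>1 t - \<phi>1 t"
          and ?f2.0 = "\<lambda>t. \<theta>2 t - \<phi>2 t" and ?f3.0 = "\<lambda>t. \<theta>3 t - \<phi>3 t"
          and ?x0.0 = "\<tau> k" and ?x1.0 = "\<tau> (k + 1)" and ?x2.0 = "\<tau> (k + 2)"])
       (auto intro!: derivative_intros p.D0 p.D1 p.D2 q.D0 q.D1 q.D2
         simp: \<phi>_\<tau> \<theta>_\<tau> h2 g_def m_def h_def[symmetric])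
  also have "\<dots> = 11 / 8 * (pi * \<epsilon>) * g\<^sup>2"
    using pos by (simp add: power2_eq_square power3_eq_cube)
  also have "\<dots> \<le> 11 / 8 * (pi * \<epsilon>) * (11 / 10 * m)\<^sup>2"
    using gm pos p.\<epsilon>_nonneg by (intro mult_left_mono power_mono) auto
  \<comment> \<open>The slack suffices: 11/8 times the square of 11/10 is 1.66375, below 2.\<close>
  also have "\<dots> \<le> 2 * pi * \<epsilon> * m\<^sup>2"
    using p.\<epsilon>_nonneg by (simp add: power_mult_distrib power_divide mult_right_mono)
  finally show ?thesis using pos by simp
qed

lemma second_diff: "\<bar>\<theta>2 t - \<phi>2 t\<bar> \<le> 2 * pi * \<epsilon>"
proof -
  obtain n where n: "\<tau> n \<le> t" "t < \<tau> (n + 1)" by (rule locate)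
  have "\<tau> (n - 1) < \<tau> n" "\<tau> (n + 1) < \<tau> (n + 2)"
    using \<tau>_less[of "n - 1"] \<tau>_less[of "n + 1"] by (simp_all add: add.assoc)
  \<comment> \<open>The middle zero is the node nearer to \<open>t\<close>: \<open>\<tau> n\<close>
    with \<open>k = n - 1\<close>, or \<open>\<tau> (n + 1)\<close> with
    \<open>k = n\<close>.\<close>
  then show ?thesis
    using n second_diff_near_node[of t n] second_diff_near_node[of t "n - 1"]
    by (cases "t - \<tau> n \<le> (\<tau> (n + 1) - \<tau> n) / 2") (auto simp: max_def add.commute)
qed

text \<open>Rolle's theorem on the gap containing \<open>t\<close> yields a zero of the
  differentiated phase difference within \<open>1 / c1\<close> of \<open>t\<close>; the
  second-derivative bound controls the growth from there.\<close>

lemma first_diff: "\<bar>\<theta>1 t - \<phi>1 t\<bar> \<le> 2 * pi * \<epsilon> / c1"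
proof -
  obtain n where n: "\<tau> n \<le> t" "t < \<tau> (n + 1)" by (rule locate)
  obtain z where z: "\<tau> n < z" "z < \<tau> (n + 1)"
    "(\<theta> (\<tau> (n + 1)) - \<phi> (\<tau> (n + 1))) - (\<theta> (\<tau> n) - \<phi> (\<tau> n)) = (\<tau> (n + 1) - \<tau> n) * (\<theta>1 z - \<phi>1 z)"
    using MVT2[OF \<tau>_less[of n], of "\<lambda>t. \<theta> t - \<phi> t" "\<lambda>t. \<theta>1 t - \<phi>1 t"]
    by (auto intro!: derivative_intros p.D0 q.D0)
  have z0: "\<theta>1 z - \<phi>1 z = 0" using z(3) \<tau>_less[of n] by (simp add: \<phi>_\<tau> \<theta>_\<tau>)
  have "\<bar>(\<theta>1 t - \<phi>1 t) - (\<theta>1 z - \<phi>1 z)\<bar> \<le> 2 * pi * \<epsilon> * \<bar>t - z\<bar>"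
    using field_differentiable_bound[of UNIV "\<lambda>t. \<theta>1 t - \<phi>1 t" "\<lambda>t. \<theta>2 t - \<phi>2 t" "2 * pi * \<epsilon>" t z]
      second_diff by (auto intro!: derivative_intros p.D1 q.D1)
  also have "\<dots> \<le> 2 * pi * \<epsilon> * (1 / c1)"
    using n z gap_le_inverse[of n] p.\<epsilon>_nonneg by (intro mult_left_mono) auto
  finally show ?thesis using z0 by simp
qed

lemma zeroth_diff: "\<bar>\<theta> t - \<phi> t\<bar> \<le> 2 * pi * \<epsilon> / c1\<^sup>2"
proof -
  obtain n where n: "\<tau> n \<le> t" "t < \<tau> (n + 1)" by (rule locate)
  have "\<bar>(\<theta> t - \<phi> t) - (\<theta> (\<tau> n) - \<phi> (\<tau> n))\<bar> \<le> 2 * pi * \<epsilon> / c1 * \<bar>t - \<tau> n\<bar>"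
    using field_differentiable_bound[of UNIV "\<lambda>t. \<theta> t - \<phi> t" "\<lambda>t. \<theta>1 t - \<phi>1 t" "2 * pi * \<epsilon> / c1" t "\<tau> n"]
      first_diff by (auto intro!: derivative_intros p.D0 q.D0)
  also have "\<dots> \<le> 2 * pi * \<epsilon> / c1 * (1 / c1)"
    using n gap_le_inverse[of n] p.\<epsilon>_nonneg p.c1_pos by (intro mult_left_mono) auto
  finally show ?thesis by (simp add: \<phi>_\<tau> \<theta>_\<tau> power2_eq_square)
qed

end

end


section \<open>Matching the zeros of the two representations\<close>

lemma cos_eq_0_iff: "cos x = 0 \<longleftrightarrow> (\<exists>n::int. x = (of_int n + 1 / 2) * pi)"
  unfolding cos_zero_iff_int2 by (simp add: algebra_simps)

text \<open>The index of the zero of \<open>cos \<theta>\<close> at node \<open>n\<close> increases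
  with \<open>n\<close> because both phases do. It skips nothing: a skipped zero would be a zero of
  \<open>cos \<phi>\<close> strictly between consecutive ones. Hence it advances by exactly
  one.\<close>

lemma common_nodes:
  assumes "phase c1 c2 \<epsilon> \<phi> \<phi>1 \<phi>2 \<phi>3" and "phase c1 c2 \<epsilon> \<theta> \<theta>1 \<theta>2 \<theta>3"
    and zeros: "\<And>t. cos (\<phi> t) = 0 \<longleftrightarrow> cos (\<theta> t) = 0"
    and \<tau>: "\<And>n::int. \<phi> (\<tau> n) = (of_int n + 1 / 2) * pi"
  obtains k :: int where "\<And>n. \<theta> (\<tau> n) = (of_int (n + k) + 1 / 2) * pi"
proof -
  interpret p: phase c1 c2 \<epsilon> \<phi> \<phi>1 \<phi>2 \<phi>3 by fact
  interpret q: phase c1 c2 \<epsilon> \<theta> \<theta>1 \<theta>2 \<theta>3 by fact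
  have "\<exists>k::int. \<theta> (\<tau> n) = (of_int k + 1 / 2) * pi" for n
    using zeros[of "\<tau> n"] \<tau>[of n] by (metis cos_eq_0_iff)
  then obtain K :: "int \<Rightarrow> int" where K: "\<theta> (\<tau> n) = (of_int (K n) + 1 / 2) * pi" for n
    by metis
  have level: "of_int i + 1 / 2 < (of_int j + 1 / 2 :: real) \<longleftrightarrow> i < j" for i j :: int by simp
  have less: "(of_int i + 1 / 2) * pi < (of_int j + 1 / 2) * pi \<longleftrightarrow> i < j" for i j :: int
    by (simp only: mult_less_cancel_right_pos[OF pi_gt_zero] level)
  have step: "K (n + 1) = K n + 1" for n
  proof -
    have "\<phi> (\<tau> n) < \<phi> (\<tau> (n + 1))" unfolding \<tau> less by simp
    then have "\<theta> (\<tau> n) < \<theta> (\<tau> (n + 1))" by (simp only: p.less_iff q.less_iff)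
    then have "K n < K (n + 1)" by (simp only: K less)
    moreover have "\<not> K n + 1 < K (n + 1)"
    proof
      assume *: "K n + 1 < K (n + 1)"
      define s where "s = inv \<theta> ((of_int (K n + 1) + 1 / 2) * pi)"
      have s: "\<theta> s = (of_int (K n + 1) + 1 / 2) * pi" unfolding s_def by (rule q.at_inv)
      then obtain m :: int where m: "\<phi> s = (of_int m + 1 / 2) * pi"
        using zeros[of s] by (metis cos_eq_0_iff)
      have "\<theta> (\<tau> n) < \<theta> s" "\<theta> s < \<theta> (\<tau> (n + 1))"
        unfolding s K less using * by simp_all
      then have "\<phi> (\<tau> n) < \<phi> s" "\<phi> s < \<phi> (\<tau> (n + 1))" by (simp_all only: p.less_iff q.less_iff)
      then show False unfolding m \<tau> less by simp
    qed
    ultimately show ?thesis by simp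
  qed
  have shift: "K n = n + K 0" for n
  proof (induction n rule: int_induct[where k = 0])
    case (step2 i)
    then show ?case using step[of "i - 1"] by simp
  qed (simp_all add: step)
  show ?thesis
    by (rule that[of "K 0"]) (use K shift in metis)
qed

text \<open>On differentiating the identity at a common zero of the cosines, the terms with
  amplitude derivatives drop out. This serves both the ratio formula at the nodes and the parity of
  the shift.\<close>

lemma node_identity:
  fixes a A \<phi> \<theta> :: "real \<Rightarrow> real"
  assumes "(a has_real_derivative a1) (at t)" "(\<phi> has_real_derivative \<phi>1) (at t)"
    and "(A has_real_derivative A1) (at t)" "(\<theta> has_real_derivative \<theta>1) (at t)"
    and id: "\<And>t. a t * cos (\<phi> t) = A t * cos (\<theta> t)"
    and "cos (\<phi> t) = 0" "cos (\<theta> t) = 0"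
  shows "a t * \<phi>1 * sin (\<phi> t) = A t * \<theta>1 * sin (\<theta> t)"
proof -
  have "((\<lambda>t. a t * cos (\<phi> t)) has_real_derivative - (a t * \<phi>1 * sin (\<phi> t))) (at t)"
    using assms(1,2,6) by (auto intro!: derivative_eq_intros)
  moreover have "((\<lambda>t. A t * cos (\<theta> t)) has_real_derivative - (A t * \<theta>1 * sin (\<theta> t))) (at t)"
    using assms(3,4,7) by (auto intro!: derivative_eq_intros)
  ultimately have "- (a t * \<phi>1 * sin (\<phi> t)) = - (A t * \<theta>1 * sin (\<theta> t))"
    unfolding id by (rule DERIV_unique)
  then show ?thesis by simp
qed

section \<open>Amplitudes at nodes and peaks\<close>

locale matched_representations =
  phase_pair c1 c2 \<epsilon> \<phi> \<phi>1 \<phi>2 \<phi>3 \<theta> \<theta>1 \<theta>2 \<theta>3 \<tau>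
  for c1 c2 \<epsilon> \<phi> \<phi>1 \<phi>2 \<phi>3 \<theta> \<theta>1 \<theta>2 \<theta>3 \<tau> +
  fixes a a1 A A1 :: "real \<Rightarrow> real"
  assumes a_deriv: "\<And>t. (a has_real_derivative a1 t) (at t)"
    and A_deriv: "\<And>t. (A has_real_derivative A1 t) (at t)"
    and a_lower: "\<And>t. c1 \<le> a t" and A_lower: "\<And>t. c1 \<le> A t" and A_upper: "\<And>t. A t \<le> c2"
    and a1_le: "\<And>t. \<bar>a1 t\<bar> \<le> \<epsilon> * \<phi>1 t / (2 * pi)"
    and A1_le: "\<And>t. \<bar>A1 t\<bar> \<le> \<epsilon> * \<theta>1 t / (2 * pi)"
    and identity: "\<And>t. a t * cos (\<phi> t) = A t * cos (\<theta> t)"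
begin

lemma a_pos: "0 < a t" and A_pos: "0 < A t"
  using a_lower[of t] A_lower[of t] p.c1_pos by linarith+

text \<open>The two phases agree at a node, so their sines are equal and nonzero and cancel from
  \<open>node_identity\<close>.\<close>

lemma node_ratio: "a (\<tau> n) / A (\<tau> n) = \<theta>1 (\<tau> n) / \<phi>1 (\<tau> n)"
proof -
  have c: "cos (\<phi> (\<tau> n)) = 0" "cos (\<theta> (\<tau> n)) = 0"
    by (auto simp: cos_eq_0_iff \<phi>_\<tau> \<theta>_\<tau>)
  then have "sin (\<phi> (\<tau> n)) \<noteq> 0" by (metis sin_zero_abs_cos_one abs_zero zero_neq_one)
  with node_identity[OF a_deriv p.D0 A_deriv q.D0 identity c]
  have "a (\<tau> n) * \<phi>1 (\<tau> n) = A (\<tau> n) * \<theta>1 (\<tau> n)" by (simp add: \<phi>_\<tau> \<theta>_\<tau>)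
  then show ?thesis using A_pos[of "\<tau> n"] p.\<phi>1_pos[of "\<tau> n"] by (simp add: frac_eq_eq mult.commute)
qed

context
  fixes s n
  assumes s: "\<phi> s = of_int n * pi"
begin

text \<open>This fixes the indexing: peak \<open>n\<close> follows node \<open>n - 1\<close> and
  precedes node \<open>n\<close>.\<close>

lemma between_nodes: "\<tau> (n - 1) < s" "s < \<tau> n"
proof -
  have "\<phi> (\<tau> (n - 1)) < \<phi> s" "\<phi> s < \<phi> (\<tau> n)"
    by (simp_all add: s \<phi>_\<tau>)
  then show "\<tau> (n - 1) < s" "s < \<tau> n" by (simp_all only: p.less_iff)
qed

text \<open>As \<open>sin (\<phi> s)\<close> vanishes, the addition formula factors
  \<open>cos (\<theta> s)\<close> through \<open>cos (\<phi> s)\<close>, which cancels from the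
  identity.\<close>

lemma peak_ratio: "a s / A s = cos (\<theta> s - \<phi> s)"
proof -
  have "sin (\<phi> s) = 0" using s by (simp add: sin_zero_iff_int2)
  then have "cos (\<phi> s) \<noteq> 0" by (metis sin_zero_abs_cos_one abs_zero zero_neq_one)
  moreover have "cos (\<theta> s) = cos (\<phi> s) * cos (\<theta> s - \<phi> s)"
    using \<open>sin (\<phi> s) = 0\<close> cos_add[of "\<phi> s" "\<theta> s - \<phi> s"] by simp
  ultimately have "a s = A s * cos (\<theta> s - \<phi> s)"
    using identity[of s] by simp
  then show ?thesis using A_pos[of s] by simp
qed

text \<open>\<open>\<theta> s\<close> is trapped between the values at the adjacent nodes. This
  places the absolute phase difference where the cosine is injective and so rules out nonzero
  multiples of 2 pi in \<open>peak_eq_iff\<close>.\<close>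

lemma peak_phase_small: "\<bar>\<theta> s - \<phi> s\<bar> < pi"
proof -
  have "\<theta> (\<tau> (n - 1)) < \<theta> s" "\<theta> s < \<theta> (\<tau> n)"
    using between_nodes by (simp_all add: q.less_iff)
  then show ?thesis using pi_gt_zero by (simp add: s \<theta>_\<tau> algebra_simps abs_less_iff)
qed

lemma peak_eq_iff: "A s = a s \<longleftrightarrow> \<theta> s = \<phi> s"
proof
  assume "A s = a s"
  then have "cos \<bar>\<theta> s - \<phi> s\<bar> = cos 0" using peak_ratio a_pos[of s] by simp
  then have "\<bar>\<theta> s - \<phi> s\<bar> = 0" using peak_phase_small by (intro cos_inj_pi[of "\<bar>\<theta> s - \<phi> s\<bar>" 0]) simp_all
  then show "\<theta> s = \<phi> s" by simp
qed (use peak_ratio a_pos[of s] A_pos[of s] in \<open>auto simp: field_simps\<close>)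

end

text \<open>Each phase increases by pi across a gap, so the growth conditions integrate to at most
  \<epsilon> (pi + pi) / (2 pi) = \<epsilon>.\<close>

lemma amplitude_diff_variation:
  assumes x: "x \<in> {\<tau> n..\<tau> (n + 1)}" and y: "y \<in> {\<tau> n..\<tau> (n + 1)}"
  shows "\<bar>(A x - a x) - (A y - a y)\<bar> \<le> \<epsilon>"
proof -
  let ?W = "\<lambda>t. \<epsilon> * (\<phi> t + \<theta> t) / (2 * pi)"
  have W_mono: "?W u \<le> ?W v" if "u \<le> v" for u v
    using that p.\<epsilon>_nonneg by (intro divide_right_mono mult_left_mono add_mono) (auto simp: p.le_iff q.le_iff)
  have main: "\<bar>(A v - a v) - (A u - a u)\<bar> \<le> \<epsilon>"
    if "u \<le> v" "\<tau> n \<le> u" "v \<le> \<tau> (n + 1)" for u v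
  proof -
    have "\<bar>(A v - a v) - (A u - a u)\<bar> \<le> ?W v - ?W u"
    proof (rule abs_diff_le_of_deriv_le[where f = "\<lambda>t. A t - a t" and W = ?W])
      show "((\<lambda>t. A t - a t) has_real_derivative A1 t - a1 t) (at t)" for t
        by (intro derivative_intros a_deriv A_deriv)
      show "(?W has_real_derivative \<epsilon> * (\<phi>1 t + \<theta>1 t) / (2 * pi)) (at t)" for t
        by (auto intro!: derivative_eq_intros p.D0 q.D0)
      show "\<bar>A1 t - a1 t\<bar> \<le> \<epsilon> * (\<phi>1 t + \<theta>1 t) / (2 * pi)" for t
        using a1_le[of t] A1_le[of t] by (simp add: distrib_left add_divide_distrib)
    qed fact
    also have "\<dots> \<le> ?W (\<tau> (n + 1)) - ?W (\<tau> n)"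
      using W_mono[of v "\<tau> (n + 1)"] W_mono[of "\<tau> n" u] that by linarith
    also have "\<dots> = \<epsilon>" by (simp add: \<phi>_\<tau> \<theta>_\<tau> field_simps)
    finally show ?thesis .
  qed
  show ?thesis
    using main[of x y] main[of y x] x y by (cases "x \<le> y") (auto simp: abs_minus_commute)
qed

text \<open>The gap containing \<open>t\<close> also contains a peak, where the amplitude difference
  is quadratic in \<epsilon> and, by the second threshold, at most \<epsilon>. The variation across
  the gap adds at most another \<epsilon>.\<close>

lemma amplitude_diff:
  assumes \<epsilon>_small: "\<epsilon> \<le> (c1\<^sup>2 / 10)\<^sup>2 / (4 * c2\<^sup>2)" "\<epsilon> \<le> c1 ^ 4 / (2 * pi\<^sup>2 * c2)"
  shows "\<bar>A t - a t\<bar> \<le> 2 * pi * \<epsilon>"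
proof -
  obtain n where n: "\<tau> n \<le> t" "t < \<tau> (n + 1)" by (rule locate)
  \<comment> \<open>The peak between \<open>\<tau> n\<close> and \<open>\<tau> (n + 1)\<close>
    carries the index \<open>n + 1\<close>.\<close>
  obtain s where s: "\<phi> s = of_int (n + 1) * pi" using p.at_inv by blast
  have "\<tau> n < s" "s < \<tau> (n + 1)" using between_nodes[OF s] by simp_all
  with n have var: "\<bar>(A t - a t) - (A s - a s)\<bar> \<le> \<epsilon>"
    by (intro amplitude_diff_variation[of _ n]) auto
  let ?b = "\<theta> s - \<phi> s"
  have c2: "0 < c2" using A_pos[of s] A_upper[of s] by linarith
  have "A s - a s = A s * (1 - cos ?b)"
    using peak_ratio[OF s] A_pos[of s] by (simp add: field_simps)
  also have "1 - cos ?b = 2 * (sin (?b / 2))\<^sup>2"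
  proof -
    have "1 - cos b = 2 * (sin (b / 2))\<^sup>2" for b :: real
      using cos_double_sin[of "b / 2"] by simp
    then show ?thesis .
  qed
  finally have eq: "A s - a s = A s * (2 * (sin (?b / 2))\<^sup>2)" .
  have "\<bar>sin (?b / 2)\<bar> \<le> \<bar>?b\<bar> / 2" using abs_sin_x_le_abs_x[of "?b / 2"] by simp
  also have "\<dots> \<le> pi * \<epsilon> / c1\<^sup>2" using zeroth_diff[OF \<epsilon>_small(1), of s] by (simp add: mult_ac)
  finally have "(sin (?b / 2))\<^sup>2 \<le> (pi * \<epsilon> / c1\<^sup>2)\<^sup>2"
    by (metis abs_ge_zero power2_abs power_mono)
  then have "A s * (2 * (sin (?b / 2))\<^sup>2) \<le> c2 * (2 * (pi * \<epsilon> / c1\<^sup>2)\<^sup>2)"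
    using A_upper[of s] c2 by (intro mult_mono) auto
  also have "\<dots> = \<epsilon> * (2 * pi\<^sup>2 * c2 / c1 ^ 4) * \<epsilon>"
    using p.c1_pos by (simp add: power_divide power_mult_distrib power2_eq_square power4_eq_xxxx field_simps)
  \<comment> \<open>The second threshold is the reciprocal of the constant here, so it absorbs one
    factor \<epsilon>.\<close>
  also have "\<dots> \<le> \<epsilon> * (2 * pi\<^sup>2 * c2 / c1 ^ 4) * (c1 ^ 4 / (2 * pi\<^sup>2 * c2))"
    using \<epsilon>_small(2) p.\<epsilon>_nonneg p.c1_pos c2 by (intro mult_left_mono) auto
  also have "\<dots> = \<epsilon>" using p.c1_pos c2 by simp
  finally have "A s - a s \<le> \<epsilon>" unfolding eq .
  moreover have "0 \<le> A s - a s" unfolding eq using A_pos[of s] by simp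
  ultimately have "\<bar>A t - a t\<bar> \<le> 2 * \<epsilon>" using var by linarith
  also have "\<dots> \<le> 2 * (pi * \<epsilon>)"
    using p.\<epsilon>_nonneg pi_gt3 by (simp add: mult_le_cancel_right1)
  finally show ?thesis by simp
qed

end

section \<open>From gIMT representations to phases and amplitudes\<close>

lemma gIMT_rep_phase:
  assumes "gIMT_rep \<epsilon> c1 c2 c3 a \<phi>" "0 < c1" "0 \<le> \<epsilon>"
  shows "phase c1 c2 \<epsilon> \<phi> (deriv \<phi>) ((deriv ^^ 2) \<phi>) ((deriv ^^ 3) \<phi>)"
proof -
  define \<psi> where "\<psi> t = \<phi> t / (2 * pi)" for t
  have g: "gIMT_pair \<epsilon> c1 c2 c3 a \<psi>" using assms by (simp add: gIMT_rep_def \<psi>_def[abs_def])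
  have D: "((deriv ^^ j) \<psi> has_real_derivative (deriv ^^ Suc j) \<psi> t) (at t)" if "j < 3" for j t
    using g that by (intro C_k_has_real_derivative) (auto simp: gIMT_pair_def)
  \<comment> \<open>The regularity is given for \<open>\<psi>\<close>; the factor 2 pi passes
    through each of the three available derivatives.\<close>
  have scale: "(deriv ^^ j) \<phi> = (\<lambda>t. 2 * pi * (deriv ^^ j) \<psi> t)" if "j \<le> 3" for j
    using that
  proof (induction j)
    case (Suc j)
    then have "(deriv ^^ Suc j) \<phi> = deriv (\<lambda>t. 2 * pi * (deriv ^^ j) \<psi> t)" by simp
    also have "\<dots> = (\<lambda>t. 2 * pi * (deriv ^^ Suc j) \<psi> t)"
      using Suc D[of j] by (intro ext DERIV_imp_deriv DERIV_cmult) auto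
    finally show ?case .
  qed (simp add: \<psi>_def)
  have D': "((deriv ^^ j) \<phi> has_real_derivative (deriv ^^ Suc j) \<phi> t) (at t)" if "j < 3" for j t
    using that D[of j t] scale[of j] scale[of "Suc j"] by (auto intro!: DERIV_cmult)
  show ?thesis
  proof
    show "(\<phi> has_real_derivative deriv \<phi> t) (at t)"
      "(deriv \<phi> has_real_derivative (deriv ^^ 2) \<phi> t) (at t)"
      "((deriv ^^ 2) \<phi> has_real_derivative (deriv ^^ 3) \<phi> t) (at t)" for t
      using D'[of 0 t] D'[of 1 t] D'[of 2 t] by (simp_all add: eval_nat_numeral)
    show "2 * pi * c1 \<le> deriv \<phi> t" "deriv \<phi> t \<le> 2 * pi * c2" for t
      using g scale[of 1] by (auto simp: gIMT_pair_def)
    show "\<bar>(deriv ^^ 3) \<phi> t\<bar> \<le> \<epsilon> * deriv \<phi> t" for t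
    proof -
      have "\<bar>(deriv ^^ 3) \<phi> t\<bar> = 2 * pi * \<bar>(deriv ^^ 3) \<psi> t\<bar>"
        by (simp only: scale[of 3] abs_mult) simp
      also have "\<dots> \<le> 2 * pi * (\<epsilon> * deriv \<psi> t)"
        using g by (intro mult_left_mono) (auto simp: gIMT_pair_def)
      also have "\<dots> = \<epsilon> * deriv \<phi> t" using scale[of 1] by simp
      finally show ?thesis .
    qed
  qed (use assms in auto)
qed

lemma gIMT_rep_amplitude:
  assumes "gIMT_rep \<epsilon> c1 c2 c3 a \<phi>" "0 < c1" "0 \<le> \<epsilon>"
  shows "(a has_real_derivative deriv a t) (at t)" "c1 \<le> a t" "a t \<le> c2"
    "\<bar>deriv a t\<bar> \<le> \<epsilon> * deriv \<phi> t / (2 * pi)"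
proof -
  have g: "gIMT_pair \<epsilon> c1 c2 c3 a (\<lambda>t. \<phi> t / (2 * pi))" using assms by (simp add: gIMT_rep_def)
  then show "(a has_real_derivative deriv a t) (at t)"
    using C_k_has_real_derivative[of 1 a 0] by (simp add: gIMT_pair_def)
  show "c1 \<le> a t" "a t \<le> c2" using g by (auto simp: gIMT_pair_def)
  have "deriv (\<lambda>t. \<phi> t / (2 * pi)) t = deriv \<phi> t / (2 * pi)"
    using phase.D0[OF gIMT_rep_phase[OF assms]] by (intro DERIV_imp_deriv DERIV_cdivide)
  moreover have "\<bar>deriv a t\<bar> \<le> \<epsilon> * deriv (\<lambda>t. \<phi> t / (2 * pi)) t"
    using g unfolding gIMT_pair_def by blast
  ultimately show "\<bar>deriv a t\<bar> \<le> \<epsilon> * deriv \<phi> t / (2 * pi)" by simp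
qed

section \<open>Choice of thresholds, parity of the shift, and the final assembly\<close>

theorem theorem2p1:
  fixes c1 c2 c3 :: real
  assumes "c1 > 0" and "c2 > c1" and "c3 > 0" and "c2 > c3"
  shows "\<exists>\<epsilon>0>0. \<forall>\<epsilon>. 0 \<le> \<epsilon> \<and> \<epsilon> < \<epsilon>0 \<and> \<epsilon> < c1 \<and> \<epsilon> < c3 \<longrightarrow>
    (\<forall>(a::real \<Rightarrow> real) (A::real \<Rightarrow> real) (\<phi>::real \<Rightarrow> real) (\<phi>A::real \<Rightarrow> real).
      gIMT_rep \<epsilon> c1 c2 c3 a \<phi> \<and> gIMT_rep \<epsilon> c1 c2 c3 A \<phi>A \<and>
      (\<forall>t. a t * cos (\<phi> t) = A t * cos (\<phi>A t)) \<longrightarrow>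
      (\<exists>l::int.
        let tm = (\<lambda>m::int. inv \<phi> ((of_int m + 1 / 2) * pi));
            sm = (\<lambda>m::int. inv \<phi> (of_int m * pi));
            \<alpha> = (\<lambda>t. A t - a t);
            \<beta> = (\<lambda>t. (\<phi>A t - 2 * of_int l * pi) - \<phi> t)
        in
          (\<forall>n. \<beta> (tm n) = 0) \<and>
          (\<forall>n. a (tm n) / (a (tm n) + \<alpha> (tm n))
                = (deriv \<phi> (tm n) + deriv \<beta> (tm n)) / deriv \<phi> (tm n)) \<and>
          (\<forall>n. \<alpha> (tm n) = 0 \<longleftrightarrow> deriv \<beta> (tm n) = 0) \<and>
          (\<forall>n. a (sm n) / (a (sm n) + \<alpha> (sm n)) = cos (\<beta> (sm n))) \<and>
          (\<forall>m. \<alpha> (sm m) = 0 \<longleftrightarrow> \<beta> (sm m) = 0) \<and>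
          (\<forall>t. \<bar>\<alpha> t\<bar> \<le> 2 * pi * \<epsilon>) \<and>
          (\<forall>t. \<bar>(deriv ^^ 2) \<beta> t\<bar> \<le> 2 * pi * \<epsilon>) \<and>
          (\<forall>t. \<bar>deriv \<beta> t\<bar> \<le> 2 * pi * \<epsilon> / c1) \<and>
          (\<forall>t. \<bar>\<beta> t\<bar> \<le> 2 * pi * \<epsilon> / c1\<^sup>2)))"
proof -
  \<comment> \<open>\<open>e1\<close> keeps the slopes nearly constant across two gaps;
    \<open>e2\<close> makes the quadratic amplitude difference at the peaks at most
    \<epsilon>.\<close>
  define e1 where "e1 = (c1\<^sup>2 / 10)\<^sup>2 / (4 * c2\<^sup>2)"
  define e2 where "e2 = c1 ^ 4 / (2 * pi\<^sup>2 * c2)"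
  show ?thesis
  proof (rule exI[of _ "min e1 e2"], intro conjI allI impI)
    show "0 < min e1 e2" using assms by (simp add: e1_def e2_def)
  next
    fix \<epsilon> and a A \<phi> \<phi>A :: "real \<Rightarrow> real"
    assume "0 \<le> \<epsilon> \<and> \<epsilon> < min e1 e2 \<and> \<epsilon> < c1 \<and> \<epsilon> < c3"
    then have \<epsilon>: "0 \<le> \<epsilon>" "\<epsilon> \<le> e1" "\<epsilon> \<le> e2" by auto
    assume "gIMT_rep \<epsilon> c1 c2 c3 a \<phi> \<and> gIMT_rep \<epsilon> c1 c2 c3 A \<phi>A \<and>
      (\<forall>t. a t * cos (\<phi> t) = A t * cos (\<phi>A t))"
    then have reps: "gIMT_rep \<epsilon> c1 c2 c3 a \<phi>" "gIMT_rep \<epsilon> c1 c2 c3 A \<phi>A"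
      and id: "\<And>t. a t * cos (\<phi> t) = A t * cos (\<phi>A t)" by auto
    interpret p: phase c1 c2 \<epsilon> \<phi> "deriv \<phi>" "(deriv ^^ 2) \<phi>" "(deriv ^^ 3) \<phi>"
      using reps \<open>0 < c1\<close> \<epsilon> by (intro gIMT_rep_phase)
    interpret q: phase c1 c2 \<epsilon> \<phi>A "deriv \<phi>A" "(deriv ^^ 2) \<phi>A" "(deriv ^^ 3) \<phi>A"
      using reps \<open>0 < c1\<close> \<epsilon> by (intro gIMT_rep_phase)
    note amp = gIMT_rep_amplitude[OF reps(1) \<open>0 < c1\<close> \<epsilon>(1)]
    note Amp = gIMT_rep_amplitude[OF reps(2) \<open>0 < c1\<close> \<epsilon>(1)]
    have pos: "0 < a t" "0 < A t" for t
      using amp(2)[of t] Amp(2)[of t] \<open>0 < c1\<close> by linarith+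
    define \<tau> where "\<tau> m = inv \<phi> ((of_int m + 1 / 2) * pi)" for m :: int
    have \<tau>: "\<phi> (\<tau> n) = (of_int n + 1 / 2) * pi" for n
      unfolding \<tau>_def by (rule p.at_inv)
    have "cos (\<phi> t) = 0 \<longleftrightarrow> cos (\<phi>A t) = 0" for t
      using id[of t] pos[of t] by (metis mult_eq_0_iff less_irrefl)
    then obtain k :: int where k: "\<And>n. \<phi>A (\<tau> n) = (of_int (n + k) + 1 / 2) * pi"
      using common_nodes[OF p.phase_axioms q.phase_axioms _ \<tau>] by blast
    \<comment> \<open>For odd \<open>k\<close> the sines at \<open>\<tau> 0\<close> would have
      opposite signs, contradicting \<open>node_identity\<close> since amplitudes and slopes are
      positive.\<close>
    have "even k"
    proof (rule ccontr)
      assume "odd k"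
      have *: "\<phi> (\<tau> 0) = pi / 2" "\<phi>A (\<tau> 0) = pi * of_int k + pi / 2"
        using \<tau>[of 0] k[of 0] by (simp_all add: algebra_simps)
      have s: "sin (\<phi> (\<tau> 0)) = 1" "cos (\<phi> (\<tau> 0)) = 0"
        "sin (\<phi>A (\<tau> 0)) = - 1" "cos (\<phi>A (\<tau> 0)) = 0"
        unfolding * sin_add cos_add using \<open>odd k\<close> by (simp_all add: cos_npi_int)
      have "a (\<tau> 0) * deriv \<phi> (\<tau> 0) = - (A (\<tau> 0) * deriv \<phi>A (\<tau> 0))"
        using node_identity[OF amp(1) p.D0 Amp(1) q.D0 id s(2,4)] by (simp add: s)
      moreover have "0 < a (\<tau> 0) * deriv \<phi> (\<tau> 0)" "0 < A (\<tau> 0) * deriv \<phi>A (\<tau> 0)"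
        using pos p.\<phi>1_pos q.\<phi>1_pos by simp_all
      ultimately show False by linarith
    qed
    then obtain l where l: "k = 2 * l" by blast
    \<comment> \<open>The shift by 2 l pi = k pi aligns the values at the nodes and leaves
      derivatives alone, so those of \<open>\<phi>A\<close> serve for
      \<open>\<theta>\<close>.\<close>
    define \<theta> where "\<theta> t = \<phi>A t - 2 * of_int l * pi" for t
    interpret m: matched_representations c1 c2 \<epsilon> \<phi> "deriv \<phi>" "(deriv ^^ 2) \<phi>" "(deriv ^^ 3) \<phi>"
      \<theta> "deriv \<phi>A" "(deriv ^^ 2) \<phi>A" "(deriv ^^ 3) \<phi>A" \<tau> a "deriv a" A "deriv A"
    proof
      show "(\<theta> has_real_derivative deriv \<phi>A t) (at t)" for t
        unfolding \<theta>_def by (auto intro!: derivative_eq_intros q.D0)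
      show "\<theta> (\<tau> n) = (of_int n + 1 / 2) * pi" for n
        by (simp add: \<theta>_def k l algebra_simps)
      have "cos (\<theta> t) = cos (\<phi>A t)" for t
        unfolding \<theta>_def cos_diff using cos_int_2pin[of l] sin_int_2pin[of l] by (simp add: mult_ac)
      then show "a t * cos (\<phi> t) = A t * cos (\<theta> t)" for t using id by simp
    qed (rule p.c1_pos p.\<epsilon>_nonneg q.D1 q.D2 q.lower q.upper q.third \<tau> amp Amp)+
    define \<beta> where "\<beta> t = \<theta> t - \<phi> t" for t
    have d1: "deriv \<beta> = (\<lambda>t. deriv \<phi>A t - deriv \<phi> t)"
      unfolding \<beta>_def[abs_def] by (intro ext DERIV_imp_deriv DERIV_diff p.D0 m.q.D0)
    have d2: "(deriv ^^ 2) \<beta> = (\<lambda>t. (deriv ^^ 2) \<phi>A t - (deriv ^^ 2) \<phi> t)"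
    proof -
      have "(deriv ^^ 2) \<beta> = deriv (\<lambda>t. deriv \<phi>A t - deriv \<phi> t)"
        by (simp add: numeral_2_eq_2 d1)
      also have "\<dots> = (\<lambda>t. (deriv ^^ 2) \<phi>A t - (deriv ^^ 2) \<phi> t)"
        by (intro ext DERIV_imp_deriv DERIV_diff p.D1 q.D1)
      finally show ?thesis .
    qed
    have \<epsilon>': "\<epsilon> \<le> (c1\<^sup>2 / 10)\<^sup>2 / (4 * c2\<^sup>2)" "\<epsilon> \<le> c1 ^ 4 / (2 * pi\<^sup>2 * c2)"
      using \<epsilon> by (simp_all add: e1_def e2_def)
    define \<sigma> where "\<sigma> m = inv \<phi> (of_int m * pi)" for m :: int
    have \<sigma>: "\<phi> (\<sigma> n) = of_int n * pi" for n
      unfolding \<sigma>_def by (rule p.at_inv)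
    have node: "A (\<tau> n) - a (\<tau> n) = 0 \<longleftrightarrow> deriv \<beta> (\<tau> n) = 0" for n
      using m.node_ratio[of n] pos[of "\<tau> n"] p.\<phi>1_pos[of "\<tau> n"]
      by (auto simp: d1 field_simps)
    have "let tm = \<tau>; sm = \<sigma>; \<alpha> = (\<lambda>t. A t - a t) in
          (\<forall>n. \<beta> (tm n) = 0) \<and>
          (\<forall>n. a (tm n) / (a (tm n) + \<alpha> (tm n))
                = (deriv \<phi> (tm n) + deriv \<beta> (tm n)) / deriv \<phi> (tm n)) \<and>
          (\<forall>n. \<alpha> (tm n) = 0 \<longleftrightarrow> deriv \<beta> (tm n) = 0) \<and>
          (\<forall>n. a (sm n) / (a (sm n) + \<alpha> (sm n)) = cos (\<beta> (sm n))) \<and>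
          (\<forall>m. \<alpha> (sm m) = 0 \<longleftrightarrow> \<beta> (sm m) = 0) \<and>
          (\<forall>t. \<bar>\<alpha> t\<bar> \<le> 2 * pi * \<epsilon>) \<and>
          (\<forall>t. \<bar>(deriv ^^ 2) \<beta> t\<bar> \<le> 2 * pi * \<epsilon>) \<and>
          (\<forall>t. \<bar>deriv \<beta> t\<bar> \<le> 2 * pi * \<epsilon> / c1) \<and>
          (\<forall>t. \<bar>\<beta> t\<bar> \<le> 2 * pi * \<epsilon> / c1\<^sup>2)"
      unfolding Let_def
    proof (intro conjI allI)
      show "\<beta> (\<tau> n) = 0" for n by (simp add: \<beta>_def \<tau> m.\<theta>_\<tau>)
      show "a (\<tau> n) / (a (\<tau> n) + (A (\<tau> n) - a (\<tau> n)))
          = (deriv \<phi> (\<tau> n) + deriv \<beta> (\<tau> n)) / deriv \<phi> (\<tau> n)" for n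
        using m.node_ratio[of n] by (simp add: d1)
      show "A (\<tau> n) - a (\<tau> n) = 0 \<longleftrightarrow> deriv \<beta> (\<tau> n) = 0" for n by (rule node)
      show "a (\<sigma> n) / (a (\<sigma> n) + (A (\<sigma> n) - a (\<sigma> n))) = cos (\<beta> (\<sigma> n))" for n
        using m.peak_ratio[OF \<sigma>[of n]] by (simp add: \<beta>_def)
      show "A (\<sigma> n) - a (\<sigma> n) = 0 \<longleftrightarrow> \<beta> (\<sigma> n) = 0" for n
        using m.peak_eq_iff[OF \<sigma>[of n]] by (simp add: \<beta>_def)
      show "\<bar>A t - a t\<bar> \<le> 2 * pi * \<epsilon>" for t by (rule m.amplitude_diff[OF \<epsilon>'])
      show "\<bar>(deriv ^^ 2) \<beta> t\<bar> \<le> 2 * pi * \<epsilon>" for t unfolding d2 by (rule m.second_diff[OF \<epsilon>'(1)])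
      show "\<bar>deriv \<beta> t\<bar> \<le> 2 * pi * \<epsilon> / c1" for t unfolding d1 by (rule m.first_diff[OF \<epsilon>'(1)])
      show "\<bar>\<beta> t\<bar> \<le> 2 * pi * \<epsilon> / c1\<^sup>2" for t unfolding \<beta>_def by (rule m.zeroth_diff[OF \<epsilon>'(1)])
    qed
    then show "\<exists>l::int.
        let tm = (\<lambda>m::int. inv \<phi> ((of_int m + 1 / 2) * pi));
            sm = (\<lambda>m::int. inv \<phi> (of_int m * pi));
            \<alpha> = (\<lambda>t. A t - a t);
            \<beta> = (\<lambda>t. (\<phi>A t - 2 * of_int l * pi) - \<phi> t)
        in
          (\<forall>n. \<beta> (tm n) = 0) \<and>
          (\<forall>n. a (tm n) / (a (tm n) + \<alpha> (tm n))
                = (deriv \<phi> (tm n) + deriv \<beta> (tm n)) / deriv \<phi> (tm n)) \<and>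
          (\<forall>n. \<alpha> (tm n) = 0 \<longleftrightarrow> deriv \<beta> (tm n) = 0) \<and>
          (\<forall>n. a (sm n) / (a (sm n) + \<alpha> (sm n)) = cos (\<beta> (sm n))) \<and>
          (\<forall>m. \<alpha> (sm m) = 0 \<longleftrightarrow> \<beta> (sm m) = 0) \<and>
          (\<forall>t. \<bar>\<alpha> t\<bar> \<le> 2 * pi * \<epsilon>) \<and>
          (\<forall>t. \<bar>(deriv ^^ 2) \<beta> t\<bar> \<le> 2 * pi * \<epsilon>) \<and>
          (\<forall>t. \<bar>deriv \<beta> t\<bar> \<le> 2 * pi * \<epsilon> / c1) \<and>
          (\<forall>t. \<bar>\<beta> t\<bar> \<le> 2 * pi * \<epsilon> / c1\<^sup>2)"
      unfolding \<tau>_def[abs_def] \<sigma>_def[abs_def] \<beta>_def[abs_def] \<theta>_def[abs_def] Let_def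
      by (rule exI[of _ l])
  qed
qed

end
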